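(* Let $n$ be a positive integer and let $u,v \in [n]^*$. Then $u \equiv_{\rm gram} v$ if and only if $\varphi_n(u) = \varphi_n(v)$. (In other words, $u \equiv_{\rm gram} v$ if and only if for all sub-intervals $[p,q]$ of $[n]$ (with $1\le p\le q\le n$), the maximum length of a weakly increasing subsequence of $u$ over the alphabet $[p,q]$ is equal to the maximum length of a weakly increasing subsequence of $v$ over the alphabet $[p,q]$.)
   Context: Write $[n]=\{1<2<\cdots<n\}$, $[p,q]=\{p,p+1,\ldots,q\}$, $\mathbb{N}_0$ for the non-negative integers, $[n]^*$ for the free monoid on $[n]$ (all finite words, with empty word $\varepsilon$) and $[n]^+$ for the set of non-empty words. Grammic congruence: each letter $a\in[n]$ acts on $\mathbb{N}_0^n$ on the right as follows. For $\gamma=(\gamma_1,\ldots,\gamma_n)\in\mathbb{N}_0^n$ let $t=\min\{s\in[n]: s>a,\ \gamma_s>0\}$ if this set is non-empty. Then $\gamma\cdot a=\gamma+e_a-e_t$ if $t$ is defined, and $\gamma\cdot a=\gamma+e_a$ otherwise, where $e_i$ denotes the $i$th standard basis vector. (Here $\gamma$ encodes the weakly increasing row with $\gamma_i$ symbols $i$, and the action is the effect of Schensted row insertion on the bottom row.) This extends to words by $\gamma\cdot\varepsilon=\gamma$ and $\gamma\cdot(w_1\cdots w_k)=(\cdots(\gamma\cdot w_1)\cdots)\cdot w_k$. For $u,v\in[n]^*$, $u\equiv_{\rm gram}v$ means $\gamma\cdot u=\gamma\cdot v$ for all $\gamma\in\mathbb{N}_0^n$. The map $\varphi_n$: for $w\in[n]^+$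 and $1\le p\le q\le n$, let $w_{p,q}$ be the maximal length of a weakly increasing (scattered) subsequence of $w$ with entries in $[p,q]$ (equal to $0$ if $w$ has no letter in $[p,q]$). Then $\varphi_n(w)$ is the $n\times n$ matrix over $\mathbb{R}\cup\{-\infty\}$ with $(p,q)$ entry $w_{p,q}$ if $p\le q$ and $-\infty$ if $p>q$; and $\varphi_n(\varepsilon)$ is the tropical identity matrix, with diagonal entries $0$ and all other entries $-\infty$. *)

theory Defs
  imports
    "HOL-Library.Extended_Real"
    "HOL-Library.FuncSet"
    "HOL-Library.Sublist"
    "Jordan_Normal_Form.Matrix"
begin

text \<open>The alphabet \<open>[n]\<close> is \<open>{1..n}\<close>, and words over it are the elements of \<open>lists {1..n}\<close>.\<close>

definition row_vectors :: "nat \<Rightarrow> (nat \<Rightarrow> nat) set" where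
  "row_vectors n = {1..n} \<rightarrow>\<^sub>E UNIV"

text \<open>Schensted insertion of the letter \<open>a\<close> into a row: \<open>\<gamma> + e\<^sub>a - e\<^sub>t\<close> with \<open>t\<close> the least symbol
  of the row exceeding \<open>a\<close>, and \<open>\<gamma> + e\<^sub>a\<close> if there is none. As \<open>t > a\<close> and \<open>\<gamma> t > 0\<close>, the two
  updates do not interfere and the subtraction is not truncated.\<close>

definition row_act :: "nat \<Rightarrow> (nat \<Rightarrow> nat) \<Rightarrow> nat \<Rightarrow> nat \<Rightarrow> nat" where
  "row_act n \<gamma> a =
    (let T = {s \<in> {1..n}. s > a \<and> \<gamma> s > 0}
     in if T = {} then \<gamma>(a := \<gamma> a + 1)
        else \<gamma>(a := \<gamma> a + 1, Min T := \<gamma> (Min T) - 1))"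

definition word_act :: "nat \<Rightarrow> (nat \<Rightarrow> nat) \<Rightarrow> nat list \<Rightarrow> nat \<Rightarrow> nat" where
  "word_act n \<gamma> w = foldl (row_act n) \<gamma> w"

definition gram_equiv :: "nat \<Rightarrow> nat list \<Rightarrow> nat list \<Rightarrow> bool" where
  "gram_equiv n u v \<longleftrightarrow> (\<forall>\<gamma> \<in> row_vectors n. word_act n \<gamma> u = word_act n \<gamma> v)"

definition max_incr :: "nat list \<Rightarrow> nat \<Rightarrow> nat \<Rightarrow> nat" where
  "max_incr w p q = Max {length s | s. subseq s w \<and> sorted s \<and> set s \<subseteq> {p..q}}"

definition trop_id :: "nat \<Rightarrow> ereal mat" where
  "trop_id n = mat n n (\<lambda>(i, j). if i = j then 0 else -\<infinity>)"

text \<open>Tropical matrices have entries in \<open>\<real> \<union> {-\<infinity>}\<close>, viewed inside \<^typ>\<open>ereal\<close>. The indices of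
  \<^const>\<open>mat\<close> start at \<open>0\<close>, so position \<open>(i, j)\<close> holds the entry for \<open>p = i + 1\<close>, \<open>q = j + 1\<close>.\<close>

definition phi :: "nat \<Rightarrow> nat list \<Rightarrow> ereal mat" where
  "phi n w =
    (if w = [] then trop_id n
     else mat n n (\<lambda>(i, j). if i \<le> j then ereal (real (max_incr w (i + 1) (j + 1))) else -\<infinity>))"

end

theory Submission
  imports Defs
begin

text \<open>Let \<open>S\<^sub>q(\<gamma>) = \<gamma>\<^sub>1 + \<dots> + \<gamma>\<^sub>q\<close>. Inserting a letter \<open>a\<close> fixes \<open>S\<^sub>q\<close> for \<open>q < a\<close> and replaces it by
  \<open>max (S\<^sub>q(\<gamma>)) (S\<^sub>a(\<gamma>) + 1)\<close> for \<open>q \<ge> a\<close>. By induction on \<open>w\<close> this gives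
  \<open>S\<^sub>q(\<gamma> \<cdot> w) = max\<^bsub>1 \<le> p \<le> q\<^esub> (S\<^sub>p(\<gamma>) + w\<^bsub>p,q\<^esub>)\<close>: the action of \<open>w\<close>, read in the coordinates \<open>S\<close>, is
  tropical multiplication by \<open>\<phi>\<^sub>n(w)\<close>. Conversely, \<open>w\<^bsub>p,q\<^esub>\<close> is recovered by acting on \<open>\<gamma> = N e\<^sub>p\<close>
  with \<open>N\<close> large.\<close>

section \<open>Partial sums of a row\<close>

definition row_sum :: "(nat \<Rightarrow> nat) \<Rightarrow> nat \<Rightarrow> nat" where
  "row_sum \<gamma> q = (\<Sum>i\<in>{1..q}. \<gamma> i)"

lemma row_sum_mono: "p \<le> q \<Longrightarrow> row_sum \<gamma> p \<le> row_sum \<gamma> q"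
  unfolding row_sum_def by (rule sum_mono2) auto

text \<open>The old and new entries are added on opposite sides, which avoids truncated subtraction
  when an entry decreases.\<close>

lemma row_sum_upd:
  "row_sum (\<gamma>(a := x)) q + (if a \<in> {1..q} then \<gamma> a else 0) =
    row_sum \<gamma> q + (if a \<in> {1..q} then x else 0)"
proof (cases "a \<in> {1..q}")
  case True
  have "(\<Sum>i\<in>{1..q} - {a}. (\<gamma>(a := x)) i) = (\<Sum>i\<in>{1..q} - {a}. \<gamma> i)"
    by (rule sum.cong) auto
  with True show ?thesis
    using sum.remove[of "{1..q}" a \<gamma>] sum.remove[of "{1..q}" a "\<gamma>(a := x)"]
    by (simp add: row_sum_def)
next
  case False
  then show ?thesis
    by (auto simp: row_sum_def intro!: sum.cong)
qed

text \<open>Successive differences of the partial sums recover the entries on \<open>{1..n}\<close>;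
  elsewhere both functions are \<open>undefined\<close>.\<close>

lemma row_vectors_eqI:
  assumes "\<gamma> \<in> row_vectors n" "\<delta> \<in> row_vectors n"
    and "\<And>q. q \<in> {1..n} \<Longrightarrow> row_sum \<gamma> q = row_sum \<delta> q"
  shows "\<gamma> = \<delta>"
proof (rule PiE_ext)
  show "\<gamma> \<in> {1..n} \<rightarrow>\<^sub>E UNIV" "\<delta> \<in> {1..n} \<rightarrow>\<^sub>E UNIV"
    using assms(1,2) by (simp_all add: row_vectors_def)
  fix q assume q: "q \<in> {1..n}"
  then obtain r where r: "q = Suc r"
    by (cases q) auto
  \<comment> \<open>The hypothesis does not cover \<open>r = 0\<close>, but there both sums are
    empty.\<close>
  have "row_sum \<gamma> r = row_sum \<delta> r"
    using assms(3)[of r] q r by (cases "r = 0") (auto simp: row_sum_def)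
  with assms(3)[OF q] show "\<gamma> q = \<delta> q"
    by (simp add: r row_sum_def)
qed

lemma row_act_in_row_vectors:
  assumes "\<gamma> \<in> row_vectors n" "a \<in> {1..n}"
  shows "row_act n \<gamma> a \<in> row_vectors n"
proof -
  let ?T = "{s \<in> {1..n}. s > a \<and> \<gamma> s > 0}"
  have "?T \<noteq> {} \<Longrightarrow> Min ?T \<in> ?T"
    by (rule Min_in) auto
  then show ?thesis
    using assms by (auto simp: row_act_def Let_def row_vectors_def PiE_iff extensional_def)
qed

lemma word_act_in_row_vectors:
  assumes "\<gamma> \<in> row_vectors n" "w \<in> lists {1..n}"
  shows "word_act n \<gamma> w \<in> row_vectors n"
  using assms
  by (induction w arbitrary: \<gamma>) (auto simp: word_act_def row_act_in_row_vectors)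

text \<open>Adding a symbol \<open>a\<close> raises the sums from \<open>a\<close> on by one, and
  removing a symbol \<open>t\<close> lowers those from \<open>t\<close> on again. For
  \<open>a \<le> q < t\<close> the row has no symbols in \<open>(a, q]\<close>, so the sum at
  \<open>q\<close> equals that at \<open>a\<close> and the maximum is its successor. From
  \<open>t\<close> on, the symbol \<open>t\<close> already makes the old sum at least the sum at
  \<open>a\<close> plus one.\<close>

lemma row_sum_row_act:
  assumes "a \<in> {1..n}" "q \<le> n"
  shows "row_sum (row_act n \<gamma> a) q =
    (if q < a then row_sum \<gamma> q else max (row_sum \<gamma> q) (row_sum \<gamma> a + 1))"
proof -
  define T where "T = {s \<in> {1..n}. s > a \<and> \<gamma> s > 0}"
  \<comment> \<open>Covers both an empty \<open>T\<close> and a \<open>q\<close> below its least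
    element: \<open>\<gamma>\<close> vanishes on \<open>(a, q]\<close>.\<close>
  have flat: "row_sum \<gamma> q = row_sum \<gamma> a" if "a \<le> q" "\<And>s. s \<in> T \<Longrightarrow> q < s"
  proof -
    have "(\<Sum>i\<in>{1..a}. \<gamma> i) = (\<Sum>i\<in>{1..q}. \<gamma> i)"
    proof (rule sum.mono_neutral_left)
      show "\<forall>i\<in>{1..q} - {1..a}. \<gamma> i = 0"
      proof
        fix i assume i: "i \<in> {1..q} - {1..a}"
        then have "i \<notin> T"
          using that(2)[of i] by auto
        with i assms show "\<gamma> i = 0"
          by (auto simp: T_def)
      qed
    qed (use that in auto)
    then show ?thesis
      by (simp add: row_sum_def)
  qed
  have add: "row_sum (\<gamma>(a := \<gamma> a + 1)) q = row_sum \<gamma> q + (if a \<le> q then 1 else 0)"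
    using row_sum_upd[of \<gamma> a "\<gamma> a + 1" q] assms(1) by (auto split: if_splits)
  show ?thesis
  proof (cases "T = {}")
    case True
    then have "row_act n \<gamma> a = \<gamma>(a := \<gamma> a + 1)"
      by (simp add: row_act_def T_def)
    with add flat True show ?thesis
      by auto
  next
    case False
    define t where "t = Min T"
    have "finite T"
      by (simp add: T_def)
    with False have t: "t \<in> T" and least: "\<And>s. s \<in> T \<Longrightarrow> t \<le> s"
      by (simp_all add: t_def)
    have at: "a < t" "\<gamma> t > 0"
      using t by (auto simp: T_def)
    have act: "row_act n \<gamma> a = (\<gamma>(a := \<gamma> a + 1))(t := \<gamma> t - 1)"
      using False unfolding row_act_def Let_def T_def[symmetric] t_def by simp
    have *: "row_sum (row_act n \<gamma> a) q + (if t \<le> q then 1 else 0) =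
        row_sum \<gamma> q + (if a \<le> q then 1 else 0)"
      using row_sum_upd[of "\<gamma>(a := \<gamma> a + 1)" t "\<gamma> t - 1" q] add at
      unfolding act by (auto split: if_splits)
    consider "q < a" | "a \<le> q" "q < t" | "t \<le> q"
      by linarith
    then show ?thesis
    proof cases
      case 1
      with * at show ?thesis by simp
    next
      case 2
      then have "row_sum \<gamma> q = row_sum \<gamma> a"
        using flat least by (meson less_le_trans)
      with * 2 show ?thesis by simp
    next
      case 3
      obtain r where r: "t = Suc r"
        using at by (cases t) auto
      have "row_sum \<gamma> a + 1 \<le> row_sum \<gamma> r + \<gamma> t"
        using row_sum_mono[of a r \<gamma>] at r by simp
      also have "\<dots> = row_sum \<gamma> t"
        by (simp add: r row_sum_def)
      also have "\<dots> \<le> row_sum \<gamma> q"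
        by (rule row_sum_mono[OF 3])
      finally show ?thesis
        using * 3 at by simp
    qed
  qed
qed

section \<open>Longest weakly increasing subsequences over an interval\<close>

lemma finite_incr_lengths:
  "finite {length s | s. subseq s w \<and> sorted s \<and> set s \<subseteq> {p..q}}"
  by (rule finite_subset[of _ "{..length w}"]) (auto dest: list_emb_length)

lemma length_le_max_incr:
  assumes "subseq s w" "sorted s" "set s \<subseteq> {p..q}"
  shows "length s \<le> max_incr w p q"
  unfolding max_incr_def by (rule Max_ge[OF finite_incr_lengths]) (use assms in blast)

lemma max_incr_obtain:
  obtains s where "subseq s w" "sorted s" "set s \<subseteq> {p..q}" "length s = max_incr w p q"
proof -
  \<comment> \<open>The empty subsequence is always admissible, so \<open>Max\<close> is taken over
    a non-empty set.\<close>
  have "length ([] :: nat list) \<in> {length s | s. subseq s w \<and> sorted s \<and> set s \<subseteq> {p..q}}"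
    by (intro CollectI exI[of _ "[]"]) auto
  then have "max_incr w p q \<in> {length s | s. subseq s w \<and> sorted s \<and> set s \<subseteq> {p..q}}"
    unfolding max_incr_def by (intro Max_in finite_incr_lengths) blast
  then show ?thesis
    using that by auto
qed

lemma max_incr_antimono:
  assumes "p \<le> p'"
  shows "max_incr w p' q \<le> max_incr w p q"
proof -
  obtain s where s: "subseq s w" "sorted s" "set s \<subseteq> {p'..q}" "length s = max_incr w p' q"
    by (rule max_incr_obtain)
  then have "set s \<subseteq> {p..q}"
    using assms by force
  with s show ?thesis
    by (metis length_le_max_incr)
qed

lemma max_incr_le_length: "max_incr w p q \<le> length w"
  by (rule max_incr_obtain[of w p q]) (metis list_emb_length)

lemma max_incr_Nil [simp]: "max_incr [] p q = 0"
  using max_incr_le_length[of "[]" p q] by simp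

lemma max_incr_pos:
  assumes "a \<in> set w"
  shows "0 < max_incr w a a"
  using length_le_max_incr[of "[a]" w a a] assms by (simp add: subseq_singleton_left)

lemma max_incr_le_Cons: "max_incr w p q \<le> max_incr (a # w) p q"
  by (rule max_incr_obtain[of w p q]) (metis length_le_max_incr list_emb_Cons)

lemma Suc_max_incr_le_Cons:
  assumes "p \<le> a" "a \<le> q"
  shows "Suc (max_incr w a q) \<le> max_incr (a # w) p q"
proof -
  obtain s where s: "subseq s w" "sorted s" "set s \<subseteq> {a..q}" "length s = max_incr w a q"
    by (rule max_incr_obtain)
  have "length (a # s) \<le> max_incr (a # w) p q"
    using s assms by (intro length_le_max_incr) force+
  with s show ?thesis
    by simp
qed

text \<open>A longest subsequence either avoids the head \<open>a\<close> or starts with it; in the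
  latter case sortedness confines its tail to \<open>{a..q}\<close>.\<close>

lemma max_incr_Cons_cases:
  obtains "max_incr (a # w) p q \<le> max_incr w p q"
  | "p \<le> a" "a \<le> q" "max_incr (a # w) p q \<le> Suc (max_incr w a q)"
proof -
  obtain s where s: "subseq s (a # w)" "sorted s" "set s \<subseteq> {p..q}"
      "length s = max_incr (a # w) p q"
    by (rule max_incr_obtain)
  show ?thesis
  proof (cases "subseq s w")
    case True
    with s that(1) show ?thesis
      by (metis length_le_max_incr)
  next
    case False
    then obtain s' where s': "s = a # s'" "subseq s' w"
      using s(1) by (cases s) (auto split: if_splits)
    have "set s' \<subseteq> {a..q}"
      using s(2,3) s'(1) by force
    then have "length s' \<le> max_incr w a q"
      using s(2) s' by (intro length_le_max_incr) auto
    with s s' that(2) show ?thesis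
      by auto
  qed
qed

section \<open>The action of a word on partial sums\<close>

text \<open>One half of the tropical product formula: every \<open>p\<close> gives a lower bound.
  The induction generalises \<open>p\<close>, since using the first letter \<open>a\<close> moves
  the lower end of the interval to \<open>a\<close>.\<close>

lemma row_sum_word_act_ge:
  assumes "w \<in> lists {1..n}" "p \<le> q" "q \<le> n"
  shows "row_sum \<gamma> p + max_incr w p q \<le> row_sum (word_act n \<gamma> w) q"
  using assms
proof (induction w arbitrary: \<gamma> p)
  case Nil
  then show ?case
    by (simp add: word_act_def row_sum_mono)
next
  case (Cons a w)
  let ?\<gamma> = "row_act n \<gamma> a"
  have a: "a \<in> {1..n}"
    by (rule Cons.hyps)
  have IH: "row_sum ?\<gamma> r + max_incr w r q \<le> row_sum (word_act n \<gamma> (a # w)) q" if "r \<le> q" for r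
    using Cons that by (simp add: word_act_def)
  show ?case
  proof (rule max_incr_Cons_cases[of a w p q])
    assume "max_incr (a # w) p q \<le> max_incr w p q"
    moreover have "row_sum \<gamma> p \<le> row_sum ?\<gamma> p"
      using Cons.prems by (simp add: row_sum_row_act[OF a])
    ultimately show ?thesis
      using IH[of p] Cons.prems by linarith
  next
    assume *: "p \<le> a" "a \<le> q" "max_incr (a # w) p q \<le> Suc (max_incr w a q)"
    have "row_sum \<gamma> p + 1 \<le> row_sum \<gamma> a + 1"
      using row_sum_mono[OF *(1)] by simp
    also have "\<dots> \<le> row_sum ?\<gamma> a"
      using a by (simp add: row_sum_row_act[OF a])
    finally show ?thesis
      using IH[of a] * by linarith
  qed
qed

text \<open>The other half: some \<open>p\<close> attains the maximum. The witness for the tail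
  either persists or is replaced by the first letter.\<close>

lemma row_sum_word_act_le:
  assumes "w \<in> lists {1..n}" "1 \<le> q" "q \<le> n"
  shows "\<exists>p\<in>{1..q}. row_sum (word_act n \<gamma> w) q \<le> row_sum \<gamma> p + max_incr w p q"
  using assms
proof (induction w arbitrary: \<gamma>)
  case Nil
  then show ?case
    by (auto simp: word_act_def)
next
  case (Cons a w)
  let ?\<gamma> = "row_act n \<gamma> a"
  have a: "a \<in> {1..n}"
    by (rule Cons.hyps)
  obtain p where p: "p \<in> {1..q}"
      and le: "row_sum (word_act n \<gamma> (a # w)) q \<le> row_sum ?\<gamma> p + max_incr w p q"
    using Cons.IH[of ?\<gamma>] Cons.prems by (auto simp: word_act_def)
  \<comment> \<open>These are the two arguments of the maximum in \<open>row_sum_row_act\<close>;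
    the second one makes \<open>a\<close> the new witness.\<close>
  consider "row_sum ?\<gamma> p = row_sum \<gamma> p" | "a \<le> p" "row_sum ?\<gamma> p = row_sum \<gamma> a + 1"
    using p Cons.prems row_sum_row_act[OF a, of p \<gamma>]
    by (cases "p < a"; cases "row_sum \<gamma> a < row_sum \<gamma> p") (auto simp: max_def)
  then show ?case
  proof cases
    case 1
    with p le max_incr_le_Cons[of w p q a] show ?thesis
      by (intro bexI[of _ p]) auto
  next
    case 2
    \<comment> \<open>As \<open>a \<le> p\<close>, a subsequence over \<open>{p..q}\<close> stays
      sorted when \<open>a\<close> is put in front.\<close>
    have "max_incr w p q + 1 \<le> max_incr (a # w) a q"
      using max_incr_antimono[OF 2(1), of w q] Suc_max_incr_le_Cons[of a a q w] 2 p by simp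
    with 2 le p a show ?thesis
      by (intro bexI[of _ a]) auto
  qed
qed

section \<open>Grammic congruence and subsequence lengths\<close>

lemma gram_equiv_if_max_incr_eq:
  assumes "u \<in> lists {1..n}" "v \<in> lists {1..n}"
    and eq: "\<And>p q. 1 \<le> p \<Longrightarrow> p \<le> q \<Longrightarrow> q \<le> n \<Longrightarrow> max_incr u p q = max_incr v p q"
  shows "gram_equiv n u v"
proof -
  \<comment> \<open>The \<open>p\<close> attaining the maximum for \<open>x\<close> gives a lower
    bound for \<open>y\<close>. The words are left generic so that antisymmetry can use both
    directions.\<close>
  have le: "row_sum (word_act n \<gamma> x) q \<le> row_sum (word_act n \<gamma> y) q"
    if xy: "x \<in> lists {1..n}" "y \<in> lists {1..n}" "q \<in> {1..n}"
      and eq': "\<And>p. p \<in> {1..q} \<Longrightarrow> max_incr x p q = max_incr y p q" for x y q \<gamma>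
  proof -
    obtain p where "p \<in> {1..q}" "row_sum (word_act n \<gamma> x) q \<le> row_sum \<gamma> p + max_incr x p q"
      using row_sum_word_act_le[of x n q \<gamma>] xy by auto
    then show ?thesis
      using row_sum_word_act_ge[of y n p q \<gamma>] xy eq'[of p] by simp
  qed
  show ?thesis
    unfolding gram_equiv_def
    using assms
    by (intro ballI row_vectors_eqI[of _ n] word_act_in_row_vectors antisym le) auto
qed

lemma max_incr_le_if_gram_equiv:
  assumes "u \<in> lists {1..n}" "v \<in> lists {1..n}" "gram_equiv n u v" "1 \<le> p" "p \<le> q" "q \<le> n"
  shows "max_incr u p q \<le> max_incr v p q"
proof -
  \<comment> \<open>\<open>N\<close> exceeds every \<open>max_incr v r q\<close>, so for
    \<open>v\<close> the maximum cannot be attained at an \<open>r < p\<close>, where the sum of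
    \<open>\<gamma>\<close> is \<open>0\<close>.\<close>
  define N where "N = Suc (length v)"
  define \<gamma> where "\<gamma> = (\<lambda>i\<in>{1..n}. if i = p then N else 0)"
  have \<gamma>: "\<gamma> \<in> row_vectors n"
    by (simp add: \<gamma>_def row_vectors_def)
  have S: "row_sum \<gamma> r = (if p \<le> r then N else 0)" if "r \<le> n" for r
  proof -
    have "row_sum \<gamma> r = (\<Sum>i\<in>{1..r}. if i = p then N else 0)"
      unfolding row_sum_def by (rule sum.cong) (use that in \<open>auto simp: \<gamma>_def\<close>)
    also have "\<dots> = (if p \<le> r then N else 0)"
      using assms(4) by simp
    finally show ?thesis .
  qed
  have "N + max_incr u p q \<le> row_sum (word_act n \<gamma> u) q"
    using row_sum_word_act_ge[of u n p q \<gamma>] assms S[of p] by simp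
  also have "word_act n \<gamma> u = word_act n \<gamma> v"
    using assms(3) \<gamma> by (simp add: gram_equiv_def)
  finally have lower: "N + max_incr u p q \<le> row_sum (word_act n \<gamma> v) q" .
  obtain r where r: "r \<in> {1..q}"
      and upper: "row_sum (word_act n \<gamma> v) q \<le> row_sum \<gamma> r + max_incr v r q"
    using row_sum_word_act_le[of v n q \<gamma>] assms by auto
  have "p \<le> r"
  proof (rule ccontr)
    assume "\<not> p \<le> r"
    then have "N \<le> max_incr v r q"
      using lower upper S[of r] r assms(6) by simp
    then show False
      using max_incr_le_length[of v r q] by (simp add: N_def)
  qed
  \<comment> \<open>For \<open>r \<ge> p\<close> the sum of \<open>\<gamma>\<close> is also
    \<open>N\<close>, which cancels.\<close>
  then have "max_incr u p q \<le> max_incr v r q"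
    using lower upper S[of r] r assms(6) by simp
  also have "\<dots> \<le> max_incr v p q"
    by (rule max_incr_antimono[OF \<open>p \<le> r\<close>])
  finally show ?thesis .
qed

lemma gram_equiv_iff_max_incr:
  assumes "u \<in> lists {1..n}" "v \<in> lists {1..n}"
  shows "gram_equiv n u v \<longleftrightarrow>
    (\<forall>p q. 1 \<le> p \<and> p \<le> q \<and> q \<le> n \<longrightarrow> max_incr u p q = max_incr v p q)"
proof
  assume *: "gram_equiv n u v"
  then have "gram_equiv n v u"
    by (simp add: gram_equiv_def)
  with * show "\<forall>p q. 1 \<le> p \<and> p \<le> q \<and> q \<le> n \<longrightarrow> max_incr u p q = max_incr v p q"
    using assms by (auto intro!: antisym max_incr_le_if_gram_equiv[of _ n])
next
  assume "\<forall>p q. 1 \<le> p \<and> p \<le> q \<and> q \<le> n \<longrightarrow> max_incr u p q = max_incr v p q"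
  then show "gram_equiv n u v"
    using assms by (intro gram_equiv_if_max_incr_eq) auto
qed

text \<open>The case distinction in \<^const>\<open>phi\<close> is invisible on the diagonal, which therefore tells
  the empty word from the others.\<close>

lemma phi_diag:
  assumes "p \<in> {1..n}"
  shows "phi n w $$ (p - 1, p - 1) = ereal (real (max_incr w p p))"
  using assms by (auto simp: phi_def trop_id_def)

lemma eq_Nil_if_max_incr_diag:
  assumes "w \<in> lists {1..n}" "\<And>p. p \<in> {1..n} \<Longrightarrow> max_incr w p p = 0"
  shows "w = []"
  using assms max_incr_pos[of "hd w" w] by (cases w) auto

lemma phi_eq_iff_max_incr:
  assumes "u \<in> lists {1..n}" "v \<in> lists {1..n}"
  shows "phi n u = phi n v \<longleftrightarrow>
    (\<forall>p q. 1 \<le> p \<and> p \<le> q \<and> q \<le> n \<longrightarrow> max_incr u p q = max_incr v p q)"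
    (is "_ \<longleftrightarrow> ?R")
proof -
  \<comment> \<open>Ensures that \<open>phi\<close> takes the same branch for both words; either
    side of the equivalence supplies the diagonal equalities.\<close>
  have Nil_iff: "u = [] \<longleftrightarrow> v = []" if "\<And>p. p \<in> {1..n} \<Longrightarrow> max_incr u p p = max_incr v p p"
    using eq_Nil_if_max_incr_diag[OF assms(1)] eq_Nil_if_max_incr_diag[OF assms(2)] that
    by (metis max_incr_Nil)
  show ?thesis
  proof
    assume eq: "phi n u = phi n v"
    have "max_incr u p p = max_incr v p p" if "p \<in> {1..n}" for p
      using phi_diag[OF that, of u] phi_diag[OF that, of v] eq by simp
    then have nil: "u = [] \<longleftrightarrow> v = []"
      by (rule Nil_iff)
    show ?R
    proof (intro allI impI)
      fix p q assume pq: "1 \<le> p \<and> p \<le> q \<and> q \<le> n"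
      show "max_incr u p q = max_incr v p q"
      proof (cases "u = []")
        case True
        with nil show ?thesis by simp
      next
        case False
        then have "phi n x $$ (p - 1, q - 1) = ereal (real (max_incr x p q))" if "x \<in> {u, v}" for x
          using that nil pq by (auto simp: phi_def)
        from this[of u] this[of v] eq show ?thesis
          by simp
      qed
    qed
  next
    assume R: ?R
    then have nil: "u = [] \<longleftrightarrow> v = []"
      by (intro Nil_iff) auto
    show "phi n u = phi n v"
      using R nil by (auto simp: phi_def intro!: cong_mat)
  qed
qed

theorem theorem3p12:
  fixes n :: nat and u v :: "nat list"
  assumes "n > 0" and "u \<in> lists {1..n}" and "v \<in> lists {1..n}"
  shows "(gram_equiv n u v \<longleftrightarrow> phi n u = phi n v) \<and>
    (gram_equiv n u v \<longleftrightarrow>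
      (\<forall>p q. 1 \<le> p \<and> p \<le> q \<and> q \<le> n \<longrightarrow> max_incr u p q = max_incr v p q))"
  using gram_equiv_iff_max_incr[OF assms(2,3)] phi_eq_iff_max_incr[OF assms(2,3)] by simp

end
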